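(* Let $K:\mathcal X\to\mathcal Y$ be a compact operator with dense range between infinite-dimensional Hilbert spaces with singular value decomposition $(\sigma_j,v_j,u_j)_{j\in\mathbb N}$ such that $\sigma_1=\sigma_2<1$, and let $Z$ be Gaussian white noise. Let $x^\dagger=v_1+v_2/\sqrt2$, $y^\delta=Kx^\dagger+\delta Z$, and $\tau\ge2$. For the choice $$\bar k^\delta_{\mathrm{dp}}=\max_{m\in\mathbb N}k^\delta_{\mathrm{dp}}(m),\qquad \bar m^\delta_{\mathrm{dp}}=\arg\max_{m\in\mathbb N}k^\delta_{\mathrm{dp}}(m)$$ there holds $$\limsup_{\delta\to0}\ \mathbb P\left(\|x^\delta_{\bar k^\delta_{\mathrm{dp}},\bar m^\delta_{\mathrm{dp}}}-x^\dagger\|>\frac1{\sqrt2}\right)\ge\frac1{48}.$$ In particular, $x^\delta_{\bar k^\delta_{\mathrm{dp}},\bar m^\delta_{\mathrm{dp}}}$ does not converge to $x^\dagger$ (in probability) as $\delta\to0$.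
   Context: $\mathbb N=\{1,2,\dots\}$. The singular value decomposition satisfies $\sigma_1\ge\sigma_2\ge\dots>0$, $(u_j)$ and $(v_j)$ are orthonormal bases of $\mathcal Y$ and $\mathcal N(K)^\perp$, $Kv_j=\sigma_ju_j$, $K^*u_j=\sigma_jv_j$. Gaussian white noise: $(Z,u_j)$, $j\in\mathbb N$, are i.i.d. standard normal, and $(y^\delta,u_j)=(Kx^\dagger,u_j)+\delta(Z,u_j)$, with noise level $\delta>0$. Landweber iteration: $P_m=\sum_{j=1}^m(u_j,\cdot)u_j$, and $x^\delta_{0,m}=0$, $x^\delta_{k+1,m}=x^\delta_{k,m}-(P_mK)^*(P_mKx^\delta_{k,m}-P_my^\delta)$; equivalently $x^\delta_{k,m}=\sum_{j=1}^m\frac{1-(1-\sigma_j^2)^k}{\sigma_j}(y^\delta,u_j)v_j$. Discrepancy principle: $k^\delta_{\mathrm{dp}}(m)=\min\{k\in\mathbb N:\|P_mKx^\delta_{k,m}-P_my^\delta\|\le\tau\sqrt m\,\delta\}$. *)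

theory Defs
  imports "HOL-Probability.Probability"
begin

text \<open>Sequences and the discretisation level \<open>m\<close> are indexed by \<open>{1, 2, \<dots>}\<close>; values at \<open>0\<close> are irrelevant throughout.\<close>

definition compact_operator :: "('x::real_normed_vector \<Rightarrow> 'y::real_normed_vector) \<Rightarrow> bool" where
  "compact_operator K \<longleftrightarrow>
     bounded_linear K \<and> (\<forall>S. bounded S \<longrightarrow> compact (closure (K ` S)))"

definition orthonormal_basis_of :: "(nat \<Rightarrow> 'x::real_inner) \<Rightarrow> 'x set \<Rightarrow> bool" where
  "orthonormal_basis_of e S \<longleftrightarrow>
     (\<forall>i\<ge>1. \<forall>j\<ge>1. e i \<bullet> e j = (if i = j then 1 else 0)) \<and>
     closure (span (e ` {1..})) = S"

definition singular_value_decomposition ::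
    "('x::real_inner \<Rightarrow> 'y::real_inner) \<Rightarrow> (nat \<Rightarrow> real) \<Rightarrow> (nat \<Rightarrow> 'x) \<Rightarrow> (nat \<Rightarrow> 'y) \<Rightarrow> bool" where
  "singular_value_decomposition K \<sigma> v u \<longleftrightarrow>
     (\<forall>j\<ge>1. 0 < \<sigma> j \<and> \<sigma> (Suc j) \<le> \<sigma> j) \<and>
     orthonormal_basis_of u UNIV \<and>
     orthonormal_basis_of v (orthogonal_comp {x. K x = 0}) \<and>
     (\<forall>j\<ge>1. K (v j) = \<sigma> j *\<^sub>R u j \<and> adjoint K (u j) = \<sigma> j *\<^sub>R v j)"

text \<open>
  White noise, and hence the data, is not an element of the Hilbert space \<open>'y\<close>, but is only
  accessible through its pairings: \<open>Z y \<omega>\<close> stands for \<open>(Z, y)\<close> at the outcome \<open>\<omega>\<close>, and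
  generalised data are functions \<open>\<phi> :: 'y \<Rightarrow> real\<close>, where \<open>\<phi> y\<close> stands for the pairing of \<open>\<phi>\<close>
  with \<open>y\<close>. A proper element \<open>z :: 'y\<close> is identified with \<open>inner z\<close>.
\<close>

definition gaussian_white_noise ::
    "'w measure \<Rightarrow> (nat \<Rightarrow> 'y) \<Rightarrow> ('y \<Rightarrow> 'w \<Rightarrow> real) \<Rightarrow> bool" where
  "gaussian_white_noise M u Z \<longleftrightarrow>
     prob_space.indep_vars M (\<lambda>_. borel) (\<lambda>j. Z (u j)) {1..} \<and>
     (\<forall>j\<ge>1. distributed M lborel (Z (u j)) (\<lambda>t. ennreal (std_normal_density t)))"

definition noisy_data :: "'y::real_inner \<Rightarrow> real \<Rightarrow> ('y \<Rightarrow> 'w \<Rightarrow> real) \<Rightarrow> 'w \<Rightarrow> ('y \<Rightarrow> real)" where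
  "noisy_data z \<delta> Z \<omega> = (\<lambda>y. z \<bullet> y + \<delta> * Z y \<omega>)"

text \<open>The projection \<open>P\<^sub>m\<close>, extended to generalised data.\<close>
definition proj :: "(nat \<Rightarrow> 'y::real_inner) \<Rightarrow> nat \<Rightarrow> ('y \<Rightarrow> real) \<Rightarrow> 'y" where
  "proj u m \<phi> = (\<Sum>j=1..m. \<phi> (u j) *\<^sub>R u j)"

abbreviation projected_op ::
    "(nat \<Rightarrow> 'y::real_inner) \<Rightarrow> nat \<Rightarrow> ('x \<Rightarrow> 'y) \<Rightarrow> 'x \<Rightarrow> 'y" where
  "projected_op u m K \<equiv> (\<lambda>x. proj u m (inner (K x)))"

primrec landweber ::
    "('x::real_inner \<Rightarrow> 'y::real_inner) \<Rightarrow> (nat \<Rightarrow> 'y) \<Rightarrow> ('y \<Rightarrow> real) \<Rightarrow> nat \<Rightarrow> nat \<Rightarrow> 'x" where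
  "landweber K u \<phi> m 0 = 0"
| "landweber K u \<phi> m (Suc k) =
     landweber K u \<phi> m k -
     adjoint (projected_op u m K) (projected_op u m K (landweber K u \<phi> m k) - proj u m \<phi>)"

definition dp_index ::
    "('x::real_inner \<Rightarrow> 'y::real_inner) \<Rightarrow> (nat \<Rightarrow> 'y) \<Rightarrow> real \<Rightarrow> real \<Rightarrow> ('y \<Rightarrow> real) \<Rightarrow> nat \<Rightarrow> nat" where
  "dp_index K u \<tau> \<delta> \<phi> m =
     (LEAST k. 1 \<le> k \<and>
        norm (projected_op u m K (landweber K u \<phi> m k) - proj u m \<phi>) \<le> \<tau> * sqrt (real m) * \<delta>)"

definition dp_max ::
    "('x::real_inner \<Rightarrow> 'y::real_inner) \<Rightarrow> (nat \<Rightarrow> 'y) \<Rightarrow> real \<Rightarrow> real \<Rightarrow> ('y \<Rightarrow> real) \<Rightarrow> nat" where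
  "dp_max K u \<tau> \<delta> \<phi> = Max (dp_index K u \<tau> \<delta> \<phi> ` {1..})"

definition is_dp_argmax ::
    "('x::real_inner \<Rightarrow> 'y::real_inner) \<Rightarrow> (nat \<Rightarrow> 'y) \<Rightarrow> real \<Rightarrow> real \<Rightarrow> ('y \<Rightarrow> real) \<Rightarrow> nat \<Rightarrow> bool" where
  "is_dp_argmax K u \<tau> \<delta> \<phi> m \<longleftrightarrow> is_arg_max (dp_index K u \<tau> \<delta> \<phi>) (\<lambda>m. 1 \<le> m) m"

end

theory Submission
  imports Defs
begin

text \<open>
  In the singular basis Landweber iteration is diagonal: the \<open>j\<close>-th coefficient of the residual
  after \<open>k\<close> steps is, up to sign, \<open>(1 - \<sigma>\<^sub>j\<^sup>2)\<^sup>k\<close> times the \<open>j\<close>-th data coefficient. The exact solution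
  only has components along \<open>v\<^sub>1\<close> and \<open>v\<^sub>2\<close>, which share the contraction factor
  \<open>q = 1 - \<sigma>\<^sub>1\<^sup>2\<close>. Up to noise, the residual is \<open>q\<^sup>k \<sigma>\<^sub>1\<close> on level \<open>m = 1\<close>, to be compared with
  \<open>\<tau> \<delta>\<close>, and \<open>q\<^sup>k \<sigma>\<^sub>1 \<surd>(3/2)\<close> on level \<open>m = 2\<close>, to be compared with \<open>\<surd>2 \<tau> \<delta>\<close>. As
  \<open>3/2 < 2\<close>, level 2 is the easier one, so level 1 tends to stop last and to be selected. The
  reconstruction then has no \<open>v\<^sub>2\<close> component at all, and this alone costs an error of \<open>1/\<surd>2\<close>.

  Since stopping indices are integers, level 1 stops strictly later only for suitable noise
  levels. Along \<open>\<delta>\<^sub>n = (9/10) \<sigma>\<^sub>1 q\<^sup>n / \<tau>\<close> the index \<open>n\<close> separates the levels: at step \<open>n\<close> the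
  residual of level 1 is about \<open>10/9 > 1\<close> times its threshold, while the squared residual
  of level 2 is about \<open>(3/2) / (2 * 81/100) < 1\<close> times its squared threshold
  (\<open>discrepancy_principle_stops_earlier\<close>). This sequence tends to zero and therefore suffices for
  the upper limit.

  The levels \<open>m \<ge> 3\<close> also stop by step \<open>n\<close> as long as the additional noise stays within the
  additional allowance, that is \<open>z\<^sub>3\<^sup>2 + \<dots> + z\<^sub>m\<^sup>2 \<le> 4 (m - 2) \<le> \<tau>\<^sup>2 (m - 2)\<close> for all \<open>m \<ge> 3\<close>. An
  exponential Markov inequality bounds the probability of violating one of these conditions by
  \<open>(2 e\<^sup>-\<^sup>3\<^sup>/\<^sup>2)\<^sup>m\<^sup>-\<^sup>2\<close>, and the geometric series of these bounds is below 1
  (\<open>some_chi_square_sum_large\<close>). Outside this event, a rare event of large \<open>z\<^sub>1\<close> or \<open>z\<^sub>2\<close>, and a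
  null set on which the \<open>v\<^sub>1\<close> component is reproduced exactly, the error exceeds \<open>1/\<surd>2\<close>.
\<close>

section \<open>Adjoints on Hilbert spaces\<close>

text \<open>
  The representing vector is the minimiser of \<open>J x = \<parallel>x\<parallel>\<^sup>2 - 2 f x\<close>. By the parallelogram law,
  minimising sequences are Cauchy. At the minimiser \<open>y\<close> the first variation of \<open>J\<close>, which is
  \<open>2 (x \<bullet> y - f x)\<close> in direction \<open>x\<close>, must vanish.
\<close>
lemma riesz_representation:
  fixes f :: "'a::{real_inner,complete_space} \<Rightarrow> real"
  assumes "bounded_linear f"
  shows "\<exists>y. \<forall>x. f x = x \<bullet> y"
proof -
  interpret f: bounded_linear f by fact
  define J where "J x = (norm x)\<^sup>2 - 2 * f x" for x
  obtain B where B: "\<And>x. \<bar>f x\<bar> \<le> norm x * B"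
    using f.bounded by auto
  have "J x \<ge> - B\<^sup>2" for x
    using B[of x] zero_le_power2[of "norm x - B"]
    by (simp add: J_def power2_eq_square algebra_simps)
  then have bdd: "bdd_below (range J)"
    by (auto simp: bdd_below_def)
  define I where "I = Inf (range J)"
  have I_le: "I \<le> J x" for x
    unfolding I_def by (rule cInf_lower[OF _ bdd]) simp
  have "\<exists>x. J x < I + 1 / Suc n" for n
    using cInf_lessD[of "range J" "I + 1 / Suc n"] by (auto simp: I_def)
  then obtain X where X: "\<And>n. J (X n) < I + 1 / Suc n" by metis
  have parallelogram: "(norm (x - y))\<^sup>2 = 2 * J x + 2 * J y - 4 * J ((1/2) *\<^sub>R (x + y))" for x y
    by (simp add: J_def power2_norm_eq_inner f.scaleR f.add inner_simps inner_commute field_simps)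
  have "(norm (x - y))\<^sup>2 \<le> 2 * J x + 2 * J y - 4 * I" for x y
    using parallelogram[of x y] I_le[of "(1/2) *\<^sub>R (x + y)"] by simp
  then have close: "(norm (X m - X n))\<^sup>2 < 4 / Suc N" if "N \<le> m" "N \<le> n" for m n N
  proof -
    have "1 / real (Suc m) \<le> 1 / Suc N" "1 / real (Suc n) \<le> 1 / Suc N"
      using that by (auto intro!: divide_left_mono)
    moreover have "4 / real (Suc N) = 4 * (1 / Suc N)" by simp
    ultimately show ?thesis
      using \<open>\<And>x y. (norm (x - y))\<^sup>2 \<le> _\<close>[of "X m" "X n"] X[of m] X[of n] by linarith
  qed
  have "Cauchy X"
  proof (rule metric_CauchyI)
    fix e :: real assume "0 < e"
    then obtain N where N: "inverse (real (Suc N)) < e\<^sup>2 / 4"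
      using reals_Archimedean[of "e\<^sup>2 / 4"] by auto
    have "dist (X m) (X n) < e" if "N \<le> m" "N \<le> n" for m n
    proof (rule power2_less_imp_less)
      have "4 / Suc N < e\<^sup>2" using N by (simp add: field_simps)
      then show "(dist (X m) (X n))\<^sup>2 < e\<^sup>2"
        using close[OF that] by (simp add: dist_norm)
    qed (use \<open>0 < e\<close> in simp)
    then show "\<exists>N. \<forall>m\<ge>N. \<forall>n\<ge>N. dist (X m) (X n) < e" by blast
  qed
  then obtain l where l: "X \<longlonglongrightarrow> l"
    using Cauchy_convergent convergent_def by blast
  have "(\<lambda>n. J (X n)) \<longlonglongrightarrow> J l"
    unfolding J_def by (intro tendsto_intros f.tendsto l)
  moreover have "(\<lambda>n. I + 1 / Suc n) \<longlonglongrightarrow> I"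
    using tendsto_add[OF tendsto_const[of I] LIMSEQ_inverse_real_of_nat]
    unfolding inverse_eq_divide by (simp only: add_0_right)
  ultimately have "J l \<le> I"
    by (rule LIMSEQ_le) (use X less_imp_le in blast)
  have "f h = h \<bullet> l" for h
  proof (rule ccontr)
    define d where "d = h \<bullet> l - f h"
    define s where "s = (norm h)\<^sup>2 + 1"
    \<comment> \<open>a step against the first variation, short enough for the linear term to dominate\<close>
    define t where "t = - (d / s)"
    assume "f h \<noteq> h \<bullet> l"
    then have "0 < d\<^sup>2" by (simp add: d_def)
    have "0 < s" by (simp add: s_def add_nonneg_pos)
    have "J (l + t *\<^sub>R h) = J l + 2 * t * d + t\<^sup>2 * (s - 1)"
      by (simp only: J_def d_def s_def power2_norm_eq_inner f.scaleR f.add)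
        (simp add: inner_simps inner_commute power2_eq_square algebra_simps)
    also have "\<dots> = J l - d\<^sup>2 / s - d\<^sup>2 / s\<^sup>2"
      using \<open>0 < s\<close> by (simp add: t_def field_simps power2_eq_square)
    also have "\<dots> < J l"
    proof -
      have "0 < d\<^sup>2 / s" "0 < d\<^sup>2 / s\<^sup>2"
        using \<open>0 < s\<close> \<open>0 < d\<^sup>2\<close> by (auto intro: divide_pos_pos)
      then show ?thesis by linarith
    qed
    finally show False using \<open>J l \<le> I\<close> I_le[of "l + t *\<^sub>R h"] by simp
  qed
  then show ?thesis by blast
qed

text \<open>
  \<^const>\<open>adjoint\<close> is a choice among all candidates and carries information only once one candidate
  is known to exist; the Riesz representation of \<open>x \<mapsto> K x \<bullet> y\<close> provides it.
\<close>
lemma bounded_linear_adjoint_works: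
  fixes K :: "'a::{real_inner,complete_space} \<Rightarrow> 'b::real_inner"
  assumes "bounded_linear K"
  shows "K x \<bullet> y = x \<bullet> adjoint K y"
proof -
  have "\<exists>z. \<forall>x. K x \<bullet> y = x \<bullet> z" for y
    by (intro riesz_representation bounded_linear_compose[OF bounded_linear_inner_left assms])
  then obtain K' where K': "\<And>x y. K x \<bullet> y = x \<bullet> K' y" by metis
  then have "adjoint K = K'" by (intro adjoint_unique) auto
  with K' show ?thesis by simp
qed

section \<open>Landweber iteration in the singular basis\<close>

locale singular_system =
  fixes K :: "'x::{real_inner,complete_space} \<Rightarrow> 'y::real_inner"
    and \<sigma> :: "nat \<Rightarrow> real" and v :: "nat \<Rightarrow> 'x" and u :: "nat \<Rightarrow> 'y"
  assumes bounded: "bounded_linear K"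
    and svd: "singular_value_decomposition K \<sigma> v u"
begin

lemma sigma_pos: "1 \<le> j \<Longrightarrow> 0 < \<sigma> j"
  and sigma_decreasing: "1 \<le> j \<Longrightarrow> \<sigma> (Suc j) \<le> \<sigma> j"
  and inner_u: "1 \<le> i \<Longrightarrow> 1 \<le> j \<Longrightarrow> u i \<bullet> u j = (if i = j then 1 else 0)"
  and inner_v: "1 \<le> i \<Longrightarrow> 1 \<le> j \<Longrightarrow> v i \<bullet> v j = (if i = j then 1 else 0)"
  and adjoint_u: "1 \<le> j \<Longrightarrow> adjoint K (u j) = \<sigma> j *\<^sub>R v j"
  using svd unfolding singular_value_decomposition_def orthonormal_basis_of_def by blast+

lemma sigma_le_first:
  assumes "1 \<le> j"
  shows "\<sigma> j \<le> \<sigma> 1"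
  using assms
proof (induction rule: dec_induct)
  case (step j)
  then show ?case using sigma_decreasing[of j] by linarith
qed simp

lemma inner_K_u: "1 \<le> j \<Longrightarrow> K x \<bullet> u j = \<sigma> j * (x \<bullet> v j)"
  using bounded_linear_adjoint_works[OF bounded, of x "u j"] by (simp add: adjoint_u)

lemma projected_op_eq: "projected_op u m K x = (\<Sum>j=1..m. (\<sigma> j * (x \<bullet> v j)) *\<^sub>R u j)"
  unfolding proj_def by (rule sum.cong) (auto simp: inner_K_u)

lemma adjoint_projected_op:
  "adjoint (projected_op u m K) = (\<lambda>y. \<Sum>j=1..m. (\<sigma> j * (y \<bullet> u j)) *\<^sub>R v j)"
  by (rule adjoint_unique)
    (simp only: projected_op_eq, simp add: inner_sum_left inner_sum_right inner_commute mult_ac)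

lemma inner_sum_u:
  assumes "j \<in> {1..m}"
  shows "(\<Sum>i=1..m. a i *\<^sub>R u i) \<bullet> u j = a j"
proof -
  have "(\<Sum>i=1..m. a i *\<^sub>R u i) \<bullet> u j = (\<Sum>i=1..m. if i = j then a j else 0)"
    unfolding inner_sum_left by (rule sum.cong) (use assms in \<open>auto simp: inner_u\<close>)
  then show ?thesis using assms by simp
qed

lemma inner_sum_v:
  assumes "j \<in> {1..m}"
  shows "(\<Sum>i=1..m. a i *\<^sub>R v i) \<bullet> v j = a j"
proof -
  have "(\<Sum>i=1..m. a i *\<^sub>R v i) \<bullet> v j = (\<Sum>i=1..m. if i = j then a j else 0)"
    unfolding inner_sum_left by (rule sum.cong) (use assms in \<open>auto simp: inner_v\<close>)
  then show ?thesis using assms by simp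
qed

text \<open>
  The hypothesis is the closed form of the \<open>k\<close>-th iterate. Stating the residual for any vector of
  this form makes it available inside the induction that establishes the closed form.
\<close>
lemma landweber_residual_step:
  assumes "x = (\<Sum>j=1..m. ((1 - (1 - (\<sigma> j)\<^sup>2) ^ k) / \<sigma> j * \<phi> (u j)) *\<^sub>R v j)"
  shows "projected_op u m K x - proj u m \<phi> = (\<Sum>j=1..m. (- ((1 - (\<sigma> j)\<^sup>2) ^ k * \<phi> (u j))) *\<^sub>R u j)"
proof -
  have "projected_op u m K x - proj u m \<phi>
      = (\<Sum>j=1..m. (\<sigma> j * (x \<bullet> v j)) *\<^sub>R u j - \<phi> (u j) *\<^sub>R u j)"
    unfolding projected_op_eq proj_def[of u m \<phi>] by (rule sum_subtractf[symmetric])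
  also have "\<dots> = (\<Sum>j=1..m. (- ((1 - (\<sigma> j)\<^sup>2) ^ k * \<phi> (u j))) *\<^sub>R u j)"
  proof (rule sum.cong)
    fix j assume j: "j \<in> {1..m}"
    have "x \<bullet> v j = (1 - (1 - (\<sigma> j)\<^sup>2) ^ k) / \<sigma> j * \<phi> (u j)"
      unfolding assms by (rule inner_sum_v[OF j])
    moreover have "\<sigma> j > 0" using j by (intro sigma_pos) auto
    ultimately have "\<sigma> j * (x \<bullet> v j) - \<phi> (u j) = - ((1 - (\<sigma> j)\<^sup>2) ^ k * \<phi> (u j))"
      by (simp add: left_diff_distrib)
    then show "(\<sigma> j * (x \<bullet> v j)) *\<^sub>R u j - \<phi> (u j) *\<^sub>R u j
        = (- ((1 - (\<sigma> j)\<^sup>2) ^ k * \<phi> (u j))) *\<^sub>R u j"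
      by (simp only: scaleR_diff_left[symmetric])
  qed simp
  finally show ?thesis .
qed

lemma landweber_eq:
  "landweber K u \<phi> m k = (\<Sum>j=1..m. ((1 - (1 - (\<sigma> j)\<^sup>2) ^ k) / \<sigma> j * \<phi> (u j)) *\<^sub>R v j)"
proof (induction k)
  case (Suc k)
  have "landweber K u \<phi> m (Suc k) =
      (\<Sum>j=1..m. ((1 - (1 - (\<sigma> j)\<^sup>2) ^ k) / \<sigma> j * \<phi> (u j)) *\<^sub>R v j -
        (\<sigma> j * ((\<Sum>j=1..m. (- ((1 - (\<sigma> j)\<^sup>2) ^ k * \<phi> (u j))) *\<^sub>R u j) \<bullet> u j)) *\<^sub>R v j)"
    using landweber_residual_step[OF Suc] Suc
    by (simp add: adjoint_projected_op sum_subtractf)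
  also have "\<dots> = (\<Sum>j=1..m. ((1 - (1 - (\<sigma> j)\<^sup>2) ^ Suc k) / \<sigma> j * \<phi> (u j)) *\<^sub>R v j)"
  proof (rule sum.cong)
    fix j assume j: "j \<in> {1..m}"
    have "\<sigma> j > 0" using j by (intro sigma_pos) auto
    then show "((1 - (1 - (\<sigma> j)\<^sup>2) ^ k) / \<sigma> j * \<phi> (u j)) *\<^sub>R v j -
        (\<sigma> j * ((\<Sum>j=1..m. (- ((1 - (\<sigma> j)\<^sup>2) ^ k * \<phi> (u j))) *\<^sub>R u j) \<bullet> u j)) *\<^sub>R v j
      = ((1 - (1 - (\<sigma> j)\<^sup>2) ^ Suc k) / \<sigma> j * \<phi> (u j)) *\<^sub>R v j"
      unfolding inner_sum_u[OF j] scaleR_diff_left[symmetric]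
      by (simp add: field_simps power2_eq_square)
  qed simp
  finally show ?case .
qed simp

lemma residual_norm_square:
  "(norm (projected_op u m K (landweber K u \<phi> m k) - proj u m \<phi>))\<^sup>2
     = (\<Sum>j=1..m. ((1 - (\<sigma> j)\<^sup>2) ^ k * \<phi> (u j))\<^sup>2)"
proof -
  define r where "r = (\<Sum>j=1..m. (- ((1 - (\<sigma> j)\<^sup>2) ^ k * \<phi> (u j))) *\<^sub>R u j)"
  have "(norm r)\<^sup>2 = (\<Sum>j=1..m. r \<bullet> ((- ((1 - (\<sigma> j)\<^sup>2) ^ k * \<phi> (u j))) *\<^sub>R u j))"
    unfolding power2_norm_eq_inner by (subst (2) r_def) (simp only: inner_sum_right)
  also have "\<dots> = (\<Sum>j=1..m. ((1 - (\<sigma> j)\<^sup>2) ^ k * \<phi> (u j))\<^sup>2)"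
  proof (rule sum.cong)
    fix j assume j: "j \<in> {1..m}"
    show "r \<bullet> ((- ((1 - (\<sigma> j)\<^sup>2) ^ k * \<phi> (u j))) *\<^sub>R u j) = ((1 - (\<sigma> j)\<^sup>2) ^ k * \<phi> (u j))\<^sup>2"
      using inner_sum_u[OF j, of "\<lambda>j. - ((1 - (\<sigma> j)\<^sup>2) ^ k * \<phi> (u j))"]
      by (simp add: r_def power2_eq_square)
  qed simp
  finally show ?thesis
    unfolding landweber_residual_step[OF landweber_eq] r_def .
qed

text \<open>
  In this form the stopping index depends on the data only through finitely many coefficients,
  which serves both its estimation and its measurability.
\<close>
lemma dp_index_eq:
  assumes "0 \<le> \<tau>" "0 \<le> \<delta>"
  shows "dp_index K u \<tau> \<delta> \<phi> m =
    (LEAST k. 1 \<le> k \<and> (\<Sum>j=1..m. ((1 - (\<sigma> j)\<^sup>2) ^ k * \<phi> (u j))\<^sup>2) \<le> \<tau>\<^sup>2 * m * \<delta>\<^sup>2)"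
proof -
  have "norm r \<le> \<tau> * sqrt m * \<delta> \<longleftrightarrow> (norm r)\<^sup>2 \<le> \<tau>\<^sup>2 * m * \<delta>\<^sup>2" for r :: 'y
    using abs_le_square_iff[of "norm r" "\<tau> * sqrt m * \<delta>"] assms
    by (simp add: power_mult_distrib)
  then show ?thesis
    unfolding dp_index_def by (simp only: residual_norm_square)
qed

end

section \<open>Measurability of the selected reconstruction\<close>

text \<open>
  At some outcomes the stopping indices may be unbounded in \<open>m\<close>. The maximum of an infinite set is
  an unspecified constant, so measurability is preserved there as well.
\<close>
lemma Max_image_eq_iff:
  fixes g :: "'i \<Rightarrow> nat"
  assumes "I \<noteq> {}"
  shows "Max (g ` I) = k \<longleftrightarrow>
    (if \<exists>N. \<forall>i\<in>I. g i \<le> N then (\<exists>i\<in>I. g i = k) \<and> (\<forall>i\<in>I. g i \<le> k) else the None = k)"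
proof (cases "finite (g ` I)")
  case True
  then have "\<exists>N. \<forall>i\<in>I. g i \<le> N" by (meson Max_ge imageI)
  moreover have "Max (g ` I) = k \<longleftrightarrow> k \<in> g ` I \<and> (\<forall>a\<in>g ` I. a \<le> k)"
    using assms True by (intro Max_eq_iff) auto
  ultimately show ?thesis by auto
next
  case False
  then have "\<not> (\<exists>N. \<forall>i\<in>I. g i \<le> N)"
    by (metis finite_nat_set_iff_bounded_le imageE)
  with False show ?thesis by (simp only: Max.infinite if_False not_False_eq_True)
qed

lemma measurable_Max_image:
  fixes f :: "nat \<Rightarrow> 'w \<Rightarrow> nat"
  assumes [measurable]: "\<And>i. f i \<in> measurable M (count_space UNIV)" and "I \<noteq> {}"
  shows "(\<lambda>\<omega>. Max ((\<lambda>i. f i \<omega>) ` I)) \<in> measurable M (count_space UNIV)"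
proof -
  have [measurable]: "Measurable.pred M (\<lambda>\<omega>. Max ((\<lambda>i. f i \<omega>) ` I) = k)" for k
    unfolding Max_image_eq_iff[OF \<open>I \<noteq> {}\<close>] Ball_def Bex_def by measurable
  have "(\<lambda>\<omega>. Max ((\<lambda>i. f i \<omega>) ` I)) -` {k} \<inter> space M
      = {\<omega> \<in> space M. Max ((\<lambda>i. f i \<omega>) ` I) = k}" for k
    by auto
  then show ?thesis
    by (simp add: measurable_count_space_eq2_countable)
qed

text \<open>
  The space need not be second countable, so sums of vector-valued functions need not be Borel
  measurable; expanding the norm reduces everything to real coefficients.
\<close>
lemma borel_measurable_norm_linear_combination:
  fixes e :: "'i \<Rightarrow> 'x::real_inner"
  assumes [measurable]: "\<And>j. j \<in> J \<Longrightarrow> f j \<in> borel_measurable M"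
  shows "(\<lambda>\<omega>. norm ((\<Sum>j\<in>J. f j \<omega> *\<^sub>R e j) - w)) \<in> borel_measurable M"
proof -
  have "norm ((\<Sum>j\<in>J. f j \<omega> *\<^sub>R e j) - w) =
      sqrt ((\<Sum>i\<in>J. \<Sum>j\<in>J. f i \<omega> * (f j \<omega> * (e i \<bullet> e j)))
        - 2 * (\<Sum>j\<in>J. f j \<omega> * (e j \<bullet> w)) + w \<bullet> w)" for \<omega>
  proof -
    define S where "S = (\<Sum>j\<in>J. f j \<omega> *\<^sub>R e j)"
    have "S \<bullet> S = (\<Sum>i\<in>J. \<Sum>j\<in>J. f i \<omega> * (f j \<omega> * (e i \<bullet> e j)))"
      unfolding S_def by (simp add: inner_sum_left inner_sum_right sum_distrib_left inner_commute mult_ac)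
    moreover have "S \<bullet> w = (\<Sum>j\<in>J. f j \<omega> * (e j \<bullet> w))"
      unfolding S_def by (simp add: inner_sum_left)
    moreover have "(S - w) \<bullet> (S - w) = S \<bullet> S - 2 * (S \<bullet> w) + w \<bullet> w"
      by (simp add: inner_diff_left inner_diff_right inner_commute)
    ultimately show ?thesis by (simp add: norm_eq_sqrt_inner S_def)
  qed
  then show ?thesis by simp
qed

context singular_system
begin

lemma measurable_dp_index:
  assumes "0 \<le> \<tau>" "0 \<le> \<delta>"
    and \<phi>: "\<And>j. 1 \<le> j \<Longrightarrow> (\<lambda>\<omega>. \<phi> \<omega> (u j)) \<in> borel_measurable M"
  shows "(\<lambda>\<omega>. dp_index K u \<tau> \<delta> (\<phi> \<omega>) m) \<in> measurable M (count_space UNIV)"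
proof -
  have [measurable]: "(\<lambda>\<omega>. \<Sum>j=1..m. ((1 - (\<sigma> j)\<^sup>2) ^ k * \<phi> \<omega> (u j))\<^sup>2) \<in> borel_measurable M" for k
    by (intro borel_measurable_sum borel_measurable_power borel_measurable_times borel_measurable_const \<phi>) simp
  show ?thesis unfolding dp_index_eq[OF assms(1,2)] by measurable
qed

lemma borel_measurable_landweber_error:
  assumes "0 \<le> \<tau>" "0 \<le> \<delta>"
    and [measurable]: "\<And>j. 1 \<le> j \<Longrightarrow> (\<lambda>\<omega>. \<phi> \<omega> (u j)) \<in> borel_measurable M"
    and [measurable]: "m \<in> measurable M (count_space UNIV)"
  shows "(\<lambda>\<omega>. norm (landweber K u (\<phi> \<omega>) (m \<omega>) (dp_max K u \<tau> \<delta> (\<phi> \<omega>)) - x)) \<in> borel_measurable M"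
proof -
  have landweber: "(\<lambda>\<omega>. norm (landweber K u (\<phi> \<omega>) i k - x)) \<in> borel_measurable M" for i k
    unfolding landweber_eq by (rule borel_measurable_norm_linear_combination) simp
  have dp_max: "(\<lambda>\<omega>. dp_max K u \<tau> \<delta> (\<phi> \<omega>)) \<in> measurable M (count_space UNIV)"
    unfolding dp_max_def
    by (rule measurable_Max_image) (auto intro!: measurable_dp_index assms(1-3))
  have "(\<lambda>\<omega>. norm (landweber K u (\<phi> \<omega>) i (dp_max K u \<tau> \<delta> (\<phi> \<omega>)) - x)) \<in> borel_measurable M" for i
    by (rule measurable_compose_countable[OF landweber dp_max])
  then show ?thesis
    by (rule measurable_compose_countable[OF _ assms(4)])
qed

end

section \<open>The first level stops last\<close>

lemma unique_arg_max:
  fixes f :: "'a \<Rightarrow> 'b::linorder"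
  assumes "P a" "\<And>x. P x \<Longrightarrow> x \<noteq> a \<Longrightarrow> f x < f a"
  shows "is_arg_max f P x \<longleftrightarrow> x = a"
  using assms unfolding is_arg_max_def
  by (metis less_asym' less_irrefl)

context singular_system
begin

lemma dp_index_le:
  fixes \<tau> \<delta> :: real
  assumes "0 \<le> \<tau>" "0 \<le> \<delta>" "1 \<le> k"
    and "(\<Sum>j=1..m. ((1 - (\<sigma> j)\<^sup>2) ^ k * \<phi> (u j))\<^sup>2) \<le> \<tau>\<^sup>2 * m * \<delta>\<^sup>2"
  shows "dp_index K u \<tau> \<delta> \<phi> m \<le> k"
  unfolding dp_index_eq[OF assms(1,2)] by (rule Least_le) (use assms in simp)

lemma contraction_factor:
  assumes "\<sigma> 1 < 1" "1 \<le> j"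
  shows "0 < 1 - (\<sigma> j)\<^sup>2" "1 - (\<sigma> j)\<^sup>2 < 1"
proof -
  have "0 < \<sigma> j" "\<sigma> j < 1"
    using sigma_pos[OF assms(2)] sigma_le_first[OF assms(2)] assms(1) by linarith+
  then show "0 < 1 - (\<sigma> j)\<^sup>2" "1 - (\<sigma> j)\<^sup>2 < 1"
    by (simp_all add: abs_square_less_1)
qed

text \<open>
  A \<^const>\<open>Least\<close> is bounded below only if some index satisfies the stopping rule at all; here the
  residual decays geometrically, so this is the case.
\<close>
lemma less_dp_index_one:
  assumes "\<sigma> 1 < 1" "0 < \<tau>" "0 < \<delta>" and n: "\<tau> * \<delta> < (1 - (\<sigma> 1)\<^sup>2) ^ n * \<phi> (u 1)"
  shows "n < dp_index K u \<tau> \<delta> \<phi> 1"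
proof -
  define q where "q = 1 - (\<sigma> 1)\<^sup>2"
  have q: "0 < q" "q < 1" using contraction_factor[of 1] assms by (auto simp: q_def)
  define P where "P k \<longleftrightarrow> 1 \<le> k \<and> \<bar>q ^ k * \<phi> (u 1)\<bar> \<le> \<tau> * \<delta>" for k
  have P_iff: "P k \<longleftrightarrow>
      1 \<le> k \<and> (\<Sum>j=1..1. ((1 - (\<sigma> j)\<^sup>2) ^ k * \<phi> (u j))\<^sup>2) \<le> \<tau>\<^sup>2 * real 1 * \<delta>\<^sup>2" for k
    using abs_le_square_iff[of "q ^ k * \<phi> (u 1)" "\<tau> * \<delta>"] assms
    by (simp add: P_def q_def power_mult_distrib)
  have "(\<lambda>k. \<bar>q ^ k * \<phi> (u 1)\<bar>) \<longlonglongrightarrow> \<bar>0 * \<phi> (u 1)\<bar>"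
    by (intro tendsto_intros LIMSEQ_power_zero) (use q in simp)
  then have "\<forall>\<^sub>F k in sequentially. \<bar>q ^ k * \<phi> (u 1)\<bar> < \<tau> * \<delta>"
    by (rule order_tendstoD) (use assms in simp)
  then have "\<forall>\<^sub>F k in sequentially. P k"
    using eventually_ge_at_top[of 1] by eventually_elim (simp add: P_def)
  then have "P (LEAST k. P k)"
    by (metis LeastI eventually_happens' sequentially_bot)
  moreover have "\<not> P k" if "k \<le> n" for k
  proof -
    have "0 < q ^ n * \<phi> (u 1)" using n assms by (simp add: q_def) (meson less_trans mult_pos_pos)
    then have "0 < \<phi> (u 1)" using q by (simp add: zero_less_mult_iff)
    moreover have "q ^ n \<le> q ^ k" using that q by (intro power_decreasing) auto
    ultimately have "q ^ n * \<phi> (u 1) \<le> q ^ k * \<phi> (u 1)" by simp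
    then show ?thesis using n by (auto simp: P_def q_def)
  qed
  ultimately show ?thesis
    unfolding dp_index_eq[OF less_imp_le[OF assms(2)] less_imp_le[OF assms(3)]] P_iff[symmetric]
    by (meson not_le)
qed

text \<open>
  The constants fit as follows. With \<open>\<bar>z\<^sub>1\<bar>, \<bar>z\<^sub>2\<bar> \<le> 12\<close> and \<open>400 \<delta> \<le> \<sigma>\<^sub>1\<close> the noise moves the first two
  data coefficients by at most \<open>(3/100) \<sigma>\<^sub>1\<close>. The first one then exceeds \<open>(9/10) \<sigma>\<^sub>1\<close>, so level 1 is
  still running at step \<open>n\<close>. Their squares add up to at most
  \<open>(103/100)\<^sup>2 \<sigma>\<^sub>1\<^sup>2 + (74/100)\<^sup>2 \<sigma>\<^sub>1\<^sup>2 \<le> 2 ((9/10) \<sigma>\<^sub>1)\<^sup>2\<close>, and \<open>q\<^sup>2\<^sup>n\<close> times this bound is \<open>2 \<tau>\<^sup>2 \<delta>\<^sup>2\<close>. Of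
  the squared threshold \<open>m \<tau>\<^sup>2 \<delta>\<^sup>2\<close> there remains \<open>(m - 2) \<tau>\<^sup>2 \<delta>\<^sup>2\<close> for the coefficients beyond the
  second, which consist of noise only.
\<close>
lemma discrepancy_principle_stops_earlier:
  fixes z :: "nat \<Rightarrow> real"
  assumes eq: "\<sigma> 1 = \<sigma> 2" and less: "\<sigma> 1 < 1" and \<tau>: "2 \<le> \<tau>" and n: "1 \<le> n" and m: "2 \<le> m"
    and \<delta>: "\<tau> * \<delta> = 9 / 10 * \<sigma> 1 * (1 - (\<sigma> 1)\<^sup>2) ^ n" and small: "400 * \<delta> \<le> \<sigma> 1"
    and \<phi>1: "\<phi> (u 1) = \<sigma> 1 + \<delta> * z 1" and \<phi>2: "\<phi> (u 2) = \<sigma> 1 / sqrt 2 + \<delta> * z 2"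
    and \<phi>3: "\<And>j. 3 \<le> j \<Longrightarrow> \<phi> (u j) = \<delta> * z j"
    and z12: "(z 1)\<^sup>2 + (z 2)\<^sup>2 \<le> 144"
    and z3: "\<And>m. 3 \<le> m \<Longrightarrow> (\<Sum>j=3..m. (z j)\<^sup>2) \<le> 4 * (real m - 2)"
  shows "dp_index K u \<tau> \<delta> \<phi> m \<le> n" "n < dp_index K u \<tau> \<delta> \<phi> 1"
proof -
  define s where "s = \<sigma> 1"
  define q where "q = 1 - s\<^sup>2"
  have s: "0 < s" using sigma_pos[of 1] by (simp add: s_def)
  have q: "0 < q" "q < 1" using contraction_factor[of 1] less by (auto simp: q_def s_def)
  have \<tau>\<delta>: "\<tau> * \<delta> = 9 / 10 * s * q ^ n" using \<delta> by (simp add: s_def q_def)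
  have "0 < \<tau> * \<delta>" unfolding \<tau>\<delta> using s q by simp
  then have "0 < \<delta>" using \<tau> by (simp add: zero_less_mult_iff)
  have dz: "\<bar>\<delta> * z j\<bar> \<le> 3 / 100 * s" if "j = 1 \<or> j = 2" for j
  proof -
    have "(z 1)\<^sup>2 \<le> 144" "(z 2)\<^sup>2 \<le> 144"
      using z12 zero_le_power2[of "z 1"] zero_le_power2[of "z 2"] by linarith+
    then have "(z j)\<^sup>2 \<le> 12\<^sup>2" using that by auto
    then have "\<bar>z j\<bar> \<le> 12" using abs_le_square_iff[of "z j" 12] by simp
    then have "\<delta> * \<bar>z j\<bar> \<le> \<delta> * 12" using \<open>0 < \<delta>\<close> by (intro mult_left_mono) auto
    also have "\<dots> \<le> 3 / 100 * s" using small by (simp add: s_def)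
    finally show ?thesis using \<open>0 < \<delta>\<close> by (simp add: abs_mult)
  qed
  have y1: "97 / 100 * s \<le> \<phi> (u 1)" "\<phi> (u 1) \<le> 103 / 100 * s"
    using dz[of 1] unfolding \<phi>1 s_def by simp_all
  show "n < dp_index K u \<tau> \<delta> \<phi> 1"
  proof (rule less_dp_index_one[OF less _ \<open>0 < \<delta>\<close>])
    have "q ^ n * (9 / 10 * s) < q ^ n * \<phi> (u 1)"
      using q y1 s by (intro mult_strict_left_mono) auto
    then have "\<tau> * \<delta> < q ^ n * \<phi> (u 1)" unfolding \<tau>\<delta> by (simp add: mult_ac)
    then show "\<tau> * \<delta> < (1 - (\<sigma> 1)\<^sup>2) ^ n * \<phi> (u 1)"
      unfolding q_def s_def .
  qed (use \<tau> in simp)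
  have "sqrt (2::real) \<ge> 100 / 71"
    by (rule real_le_rsqrt) (simp add: power2_eq_square)
  then have "s / sqrt 2 \<le> s / (100 / 71)" using s by (intro divide_left_mono) auto
  then have "s / sqrt 2 \<le> 71 / 100 * s" by simp
  then have y2: "\<bar>\<phi> (u 2)\<bar> \<le> 74 / 100 * s"
  proof -
    have "0 \<le> s / sqrt 2" using s by simp
    moreover have "\<phi> (u 2) = s / sqrt 2 + \<delta> * z 2" by (simp only: \<phi>2 s_def)
    ultimately show ?thesis
      using dz[of 2] \<open>s / sqrt 2 \<le> 71 / 100 * s\<close> by linarith
  qed
  have "(\<phi> (u 1))\<^sup>2 \<le> (103 / 100 * s)\<^sup>2"
    using y1 s by (intro power_mono) auto
  moreover have "(\<phi> (u 2))\<^sup>2 \<le> (74 / 100 * s)\<^sup>2"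
    using y2 s by (simp only: abs_le_square_iff[symmetric])
  ultimately have y12: "(\<phi> (u 1))\<^sup>2 + (\<phi> (u 2))\<^sup>2 \<le> 2 * (9 / 10 * s)\<^sup>2"
    using zero_le_power2[of s] unfolding power_mult_distrib power_divide by (simp, linarith)
  have "(\<Sum>j=3..m. (z j)\<^sup>2) \<le> 4 * (real m - 2)"
    using z3[of m] m by (cases "3 \<le> m") auto
  also have "\<dots> \<le> \<tau>\<^sup>2 * (real m - 2)"
    using m power_mono[OF \<tau>, of 2] by (intro mult_right_mono) auto
  finally have tail: "\<delta>\<^sup>2 * (\<Sum>j=3..m. (z j)\<^sup>2) \<le> \<delta>\<^sup>2 * (\<tau>\<^sup>2 * (real m - 2))"
    by (rule mult_left_mono) simp
  have high: "((1 - (\<sigma> j)\<^sup>2) ^ n * \<phi> (u j))\<^sup>2 \<le> \<delta>\<^sup>2 * (z j)\<^sup>2" if "3 \<le> j" for j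
  proof -
    have "((1 - (\<sigma> j)\<^sup>2) ^ n)\<^sup>2 \<le> 1\<^sup>2"
      using contraction_factor[OF less, of j] that by (intro power_mono power_le_one) auto
    then have "((1 - (\<sigma> j)\<^sup>2) ^ n)\<^sup>2 * (\<delta> * z j)\<^sup>2 \<le> 1 * (\<delta> * z j)\<^sup>2"
      by (intro mult_right_mono) auto
    then show ?thesis by (simp add: \<phi>3[OF that] power_mult_distrib)
  qed
  have split: "{1..m} = {1, 2} \<union> {3..m}" using m by auto
  have "(\<Sum>j=1..m. ((1 - (\<sigma> j)\<^sup>2) ^ n * \<phi> (u j))\<^sup>2)
      = (q ^ n)\<^sup>2 * ((\<phi> (u 1))\<^sup>2 + (\<phi> (u 2))\<^sup>2) + (\<Sum>j=3..m. ((1 - (\<sigma> j)\<^sup>2) ^ n * \<phi> (u j))\<^sup>2)"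
    unfolding split by (subst sum.union_disjoint)
      (auto simp: power_mult_distrib q_def s_def eq[symmetric] algebra_simps)
  also have "\<dots> \<le> (q ^ n)\<^sup>2 * (2 * (9 / 10 * s)\<^sup>2) + \<delta>\<^sup>2 * (\<tau>\<^sup>2 * (real m - 2))"
  proof (intro add_mono mult_left_mono y12)
    have "(\<Sum>j=3..m. ((1 - (\<sigma> j)\<^sup>2) ^ n * \<phi> (u j))\<^sup>2) \<le> (\<Sum>j=3..m. \<delta>\<^sup>2 * (z j)\<^sup>2)"
      by (intro sum_mono high) simp
    also have "\<dots> \<le> \<delta>\<^sup>2 * (\<tau>\<^sup>2 * (real m - 2))"
      using tail by (simp only: sum_distrib_left)
    finally show "(\<Sum>j=3..m. ((1 - (\<sigma> j)\<^sup>2) ^ n * \<phi> (u j))\<^sup>2) \<le> \<delta>\<^sup>2 * (\<tau>\<^sup>2 * (real m - 2))" .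
  qed simp
  also have "(q ^ n)\<^sup>2 * (2 * (9 / 10 * s)\<^sup>2) = 2 * (\<tau> * \<delta>)\<^sup>2"
    unfolding \<tau>\<delta> power_mult_distrib by (simp only: mult_ac)
  also have "2 * (\<tau> * \<delta>)\<^sup>2 + \<delta>\<^sup>2 * (\<tau>\<^sup>2 * (real m - 2)) = \<tau>\<^sup>2 * m * \<delta>\<^sup>2"
    by (simp add: power_mult_distrib algebra_simps)
  finally show "dp_index K u \<tau> \<delta> \<phi> m \<le> n"
    by (intro dp_index_le) (use \<tau> \<open>0 < \<delta>\<close> n in auto)
qed

text \<open>
  The missing \<open>v\<^sub>2\<close> component contributes exactly \<open>1/2\<close> to the squared error. The hypothesis says
  that the \<open>v\<^sub>1\<close> coefficient is not exactly 1, which makes the inequality strict.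
\<close>
lemma landweber_error_one:
  assumes "(1 - (1 - (\<sigma> 1)\<^sup>2) ^ k) * \<phi> (u 1) \<noteq> \<sigma> 1"
  shows "1 / sqrt 2 < norm (landweber K u \<phi> 1 k - (v 1 + (1 / sqrt 2) *\<^sub>R v 2))"
proof -
  define a where "a = (1 - (1 - (\<sigma> 1)\<^sup>2) ^ k) / \<sigma> 1 * \<phi> (u 1) - 1"
  have "a \<noteq> 0" using assms sigma_pos[of 1] by (simp add: a_def field_simps)
  have "landweber K u \<phi> 1 k - (v 1 + (1 / sqrt 2) *\<^sub>R v 2) = a *\<^sub>R v 1 - (1 / sqrt 2) *\<^sub>R v 2"
    unfolding landweber_eq by (simp add: a_def algebra_simps)
  also have "(norm \<dots>)\<^sup>2 = a\<^sup>2 + 1 / 2"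
    unfolding power2_norm_eq_inner
    by (simp add: inner_simps inner_v power2_eq_square field_simps)
  finally have "(1 / sqrt 2)\<^sup>2 < (norm (landweber K u \<phi> 1 k - (v 1 + (1 / sqrt 2) *\<^sub>R v 2)))\<^sup>2"
    using \<open>a \<noteq> 0\<close> by (simp add: power_divide)
  then show ?thesis by (rule power2_less_imp_less) simp
qed

lemma dp_argmax_unique_one:
  assumes "\<And>m. 2 \<le> m \<Longrightarrow> dp_index K u \<tau> \<delta> \<phi> m \<le> n" "n < dp_index K u \<tau> \<delta> \<phi> 1"
  shows "is_dp_argmax K u \<tau> \<delta> \<phi> m \<longleftrightarrow> m = 1"
proof -
  have "dp_index K u \<tau> \<delta> \<phi> m < dp_index K u \<tau> \<delta> \<phi> 1" if "1 \<le> m" "m \<noteq> 1" for m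
    using assms(1)[of m] assms(2) that by simp
  then show ?thesis
    unfolding is_dp_argmax_def by (rule unique_arg_max[rotated]) simp_all
qed

end

section \<open>Sums of squared standard normal variables\<close>

text \<open>
  With the exponent \<open>3/8\<close> the integrand is twice the density of a centred normal distribution with
  standard deviation 2.
\<close>
lemma nn_integral_std_normal_exp_square:
  "(\<integral>\<^sup>+x. ennreal (std_normal_density x) * ennreal (exp (3 / 8 * x\<^sup>2)) \<partial>lborel) = 2"
proof -
  have "sqrt 8 = 2 * sqrt (2::real)"
    using real_sqrt_mult[of 4 2] by simp
  then have "std_normal_density x * exp (3 / 8 * x\<^sup>2) = 2 * normal_density 0 2 x" for x
    by (simp add: std_normal_density_def normal_density_def real_sqrt_mult exp_add[symmetric] field_simps)
  then have "(\<integral>\<^sup>+x. ennreal (std_normal_density x) * ennreal (exp (3 / 8 * x\<^sup>2)) \<partial>lborel)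
     = (\<integral>\<^sup>+x. 2 * ennreal (normal_density 0 2 x) \<partial>lborel)"
    by (simp add: ennreal_mult'[symmetric] ennreal_mult normal_density_nonneg)
  also have "\<dots> = 2 * 1"
    by (subst nn_integral_cmult) (auto simp: nn_integral_eq_integral normal_density_nonneg)
  finally show ?thesis by simp
qed

context prob_space
begin

text \<open>
  The exponential moment at \<open>3/8\<close> minimises the Markov bound for \<open>t = 4 * card J\<close>, the case that is
  summed below.
\<close>
lemma chi_square_tail:
  fixes X :: "'i \<Rightarrow> 'a \<Rightarrow> real"
  assumes "finite J" and ind: "indep_vars (\<lambda>_. borel) X J"
    and dist: "\<And>j. j \<in> J \<Longrightarrow> distributed M lborel (X j) (\<lambda>t. ennreal (std_normal_density t))"
  shows "prob {\<omega> \<in> space M. t \<le> (\<Sum>j\<in>J. (X j \<omega>)\<^sup>2)} \<le> 2 ^ card J * exp (- (3 / 8 * t))"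
proof -
  have [measurable]: "X j \<in> borel_measurable M" if "j \<in> J" for j
    using distributed_measurable[OF dist[OF that]] by simp
  have "emeasure M {\<omega> \<in> space M. t \<le> (\<Sum>j\<in>J. (X j \<omega>)\<^sup>2)}
      \<le> ennreal (exp (- (3 / 8) * t)) * (\<integral>\<^sup>+\<omega>. ennreal (exp (3 / 8 * (\<Sum>j\<in>J. (X j \<omega>)\<^sup>2))) * indicator (space M) \<omega> \<partial>M)"
    by (rule Chernoff_ineq_nn_integral_ge) auto
  also have "(\<integral>\<^sup>+\<omega>. ennreal (exp (3 / 8 * (\<Sum>j\<in>J. (X j \<omega>)\<^sup>2))) * indicator (space M) \<omega> \<partial>M)
      = (\<integral>\<^sup>+\<omega>. (\<Prod>j\<in>J. ennreal (exp (3 / 8 * (X j \<omega>)\<^sup>2))) \<partial>M)"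
    by (intro nn_integral_cong)
      (simp add: sum_distrib_left exp_sum[OF \<open>finite J\<close>] prod_ennreal)
  also have "\<dots> = (\<Prod>j\<in>J. \<integral>\<^sup>+\<omega>. ennreal (exp (3 / 8 * (X j \<omega>)\<^sup>2)) \<partial>M)"
    by (rule indep_vars_nn_integral[OF \<open>finite J\<close>])
      (auto intro!: indep_vars_compose2[OF ind])
  also have "\<dots> = (\<Prod>j\<in>J. 2)"
  proof (rule prod.cong)
    fix j assume "j \<in> J"
    have "(\<integral>\<^sup>+\<omega>. ennreal (exp (3 / 8 * (X j \<omega>)\<^sup>2)) \<partial>M)
       = (\<integral>\<^sup>+x. ennreal (std_normal_density x) * ennreal (exp (3 / 8 * x\<^sup>2)) \<partial>lborel)"
      by (rule distributed_nn_integral[OF dist[OF \<open>j \<in> J\<close>], symmetric]) simp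
    then show "(\<integral>\<^sup>+\<omega>. ennreal (exp (3 / 8 * (X j \<omega>)\<^sup>2)) \<partial>M) = 2"
      by (simp only: nn_integral_std_normal_exp_square)
  qed simp
  also have "ennreal (exp (- (3 / 8) * t)) * (\<Prod>j\<in>J. 2) = ennreal (2 ^ card J * exp (- (3 / 8 * t)))"
    by (simp add: ennreal_mult ennreal_power[symmetric] mult.commute)
  finally show ?thesis
    unfolding emeasure_eq_measure by (subst (asm) ennreal_le_iff) auto
qed

text \<open>
  The bounds \<open>(2 e\<^sup>-\<^sup>3\<^sup>/\<^sup>2)\<^sup>i\<^sup>+\<^sup>1\<close> for the individual \<open>i\<close> are summable, so a union bound is enough.
\<close>
lemma some_chi_square_sum_large:
  fixes X :: "nat \<Rightarrow> 'a \<Rightarrow> real"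
  assumes ind: "indep_vars (\<lambda>_. borel) X {k..}"
    and dist: "\<And>j. k \<le> j \<Longrightarrow> distributed M lborel (X j) (\<lambda>t. ennreal (std_normal_density t))"
  shows "prob {\<omega> \<in> space M. \<exists>i. 4 * real (Suc i) \<le> (\<Sum>j=k..k+i. (X j \<omega>)\<^sup>2)} \<le> 8 / 9"
proof -
  have [measurable]: "X j \<in> borel_measurable M" if "k \<le> j" for j
    using distributed_measurable[OF dist[OF that]] by simp
  define A where "A i = {\<omega> \<in> space M. 4 * real (Suc i) \<le> (\<Sum>j=k..k+i. (X j \<omega>)\<^sup>2)}" for i
  have A: "A i \<in> events" for i unfolding A_def by measurable
  \<comment> \<open>the ratio \<open>2 e\<^sup>-\<^sup>3\<^sup>/\<^sup>2\<close> must be below \<open>1/2\<close> for a geometric sum below 1; the bound \<open>8/17\<close> leads to \<open>8/9\<close>\<close>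
  have "(1 + 1 / 2 + (1 / 2)\<^sup>2 / 2 :: real) \<le> exp (1 / 2)"
    by (rule exp_lower_Taylor_quadratic) simp
  then have "(13 / 8) ^ 3 \<le> exp (1 / 2 :: real) ^ 3"
    by (intro power_mono) (simp_all add: power2_eq_square)
  also have "exp (1 / 2 :: real) ^ 3 = exp (3 / 2)"
    by (simp add: exp_of_nat_mult[symmetric])
  finally have "17 / 4 \<le> exp (3 / 2 :: real)"
    by (simp add: power3_eq_cube)
  then have r: "2 * exp (- (3 / 2)) \<le> (8 / 17 :: real)"
    by (simp add: exp_minus field_simps)
  have A_le: "prob (A i) \<le> (8 / 17) ^ Suc i" for i
  proof -
    have "prob (A i) \<le> 2 ^ card {k..k+i} * exp (- (3 / 8 * (4 * real (Suc i))))"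
      unfolding A_def
      by (rule chi_square_tail) (auto intro!: indep_vars_subset[OF ind] dist)
    also have "exp (- (3 / 8 * (4 * real (Suc i)))) = exp (- (3 / 2) :: real) ^ Suc i"
      unfolding exp_of_nat_mult[symmetric] by (simp add: algebra_simps)
    also have "2 ^ card {k..k+i} * exp (- (3 / 2) :: real) ^ Suc i = (2 * exp (- (3 / 2))) ^ Suc i"
      by (simp add: power_mult_distrib)
    also have "\<dots> \<le> (8 / 17) ^ Suc i"
      using r by (intro power_mono) auto
    finally show ?thesis .
  qed
  have geometric: "(\<lambda>i. (8 / 17 :: real) ^ Suc i) sums (8 / 9)"
    using sums_mult[OF geometric_sums[of "8 / 17 :: real"], of "8 / 17"] by simp
  have summable: "summable (\<lambda>i. prob (A i))"
    by (rule summable_comparison_test'[OF sums_summable[OF geometric]]) (use A_le in simp)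
  have "{\<omega> \<in> space M. \<exists>i. 4 * real (Suc i) \<le> (\<Sum>j=k..k+i. (X j \<omega>)\<^sup>2)} = (\<Union>i. A i)"
    by (auto simp: A_def)
  also have "prob \<dots> \<le> (\<Sum>i. prob (A i))"
    using A summable by (intro finite_measure_subadditive_countably) auto
  also have "\<dots> \<le> (\<Sum>i. (8 / 17) ^ Suc i)"
    by (rule suminf_le[OF A_le summable sums_summable[OF geometric]])
  finally show ?thesis using sums_unique[OF geometric] by simp
qed

lemma AE_avoids_countable:
  fixes X :: "'a \<Rightarrow> real"
  assumes "distributed M lborel X f" "countable C"
  shows "AE \<omega> in M. X \<omega> \<notin> C"
proof -
  have "AE x in lborel. x \<notin> C"
    using countable_imp_null_set_lborel[OF \<open>countable C\<close>] by (rule AE_not_in)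
  then show ?thesis
    using countable_imp_null_set_lborel[OF assms(2)]
    by (subst distributed_AE2[OF assms(1)]) (auto dest: null_setsD2)
qed

end

section \<open>Failure of convergence\<close>

theorem theorem2p1:
  fixes K :: "'x::{real_inner,complete_space} \<Rightarrow> 'y::{real_inner,complete_space}"
    and \<sigma> :: "nat \<Rightarrow> real" and v :: "nat \<Rightarrow> 'x" and u :: "nat \<Rightarrow> 'y"
    and M :: "'w measure" and Z :: "'y \<Rightarrow> 'w \<Rightarrow> real"
    and xdag :: 'x and y :: "real \<Rightarrow> 'w \<Rightarrow> 'y \<Rightarrow> real" and \<tau> :: real
    and kbar mbar :: "real \<Rightarrow> 'w \<Rightarrow> nat" and err :: "real \<Rightarrow> 'w \<Rightarrow> real"
  assumes inf_dim_X: "\<And>B :: 'x set. finite B \<Longrightarrow> span B \<noteq> UNIV"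
    and inf_dim_Y: "\<And>B :: 'y set. finite B \<Longrightarrow> span B \<noteq> UNIV"
    and K_compact: "compact_operator K"
    and K_dense_range: "closure (range K) = UNIV"
    and svd: "singular_value_decomposition K \<sigma> v u"
    and sigma_eq: "\<sigma> 1 = \<sigma> 2" and sigma_less: "\<sigma> 2 < 1"
    and M: "prob_space M"
    and Z: "gaussian_white_noise M u Z"
    and xdag: "xdag = v 1 + (1 / sqrt 2) *\<^sub>R v 2"
    and y: "\<And>\<delta> \<omega>. y \<delta> \<omega> = noisy_data (K xdag) \<delta> Z \<omega>"
    and tau: "2 \<le> \<tau>"
    and kbar: "\<And>\<delta> \<omega>. kbar \<delta> \<omega> = dp_max K u \<tau> \<delta> (y \<delta> \<omega>)"
    \<comment> \<open>an arbitrary measurable choice of a maximiser, wherever one exists\<close>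
    and mbar_measurable: "\<And>\<delta>. 0 < \<delta> \<Longrightarrow> mbar \<delta> \<in> measurable M (count_space UNIV)"
    and mbar: "\<And>\<delta> \<omega>. 0 < \<delta> \<Longrightarrow> \<omega> \<in> space M \<Longrightarrow>
                 \<exists>m. is_dp_argmax K u \<tau> \<delta> (y \<delta> \<omega>) m \<Longrightarrow>
                 is_dp_argmax K u \<tau> \<delta> (y \<delta> \<omega>) (mbar \<delta> \<omega>)"
    and err: "\<And>\<delta> \<omega>. err \<delta> \<omega> =
                 norm (landweber K u (y \<delta> \<omega>) (mbar \<delta> \<omega>) (kbar \<delta> \<omega>) - xdag)"
  shows "Limsup (at_right 0)
           (\<lambda>\<delta>. ereal (measure M {\<omega> \<in> space M. err \<delta> \<omega> > 1 / sqrt 2})) \<ge> ereal (1 / 48) \<and>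
         \<not> (\<forall>\<epsilon>>0. ((\<lambda>\<delta>. measure M {\<omega> \<in> space M. err \<delta> \<omega> > \<epsilon>}) \<longlongrightarrow> 0) (at_right 0))"
proof -
  interpret prob_space M by (rule M)
  interpret singular_system K \<sigma> v u
    using K_compact svd unfolding compact_operator_def by (intro singular_system.intro) simp_all
  define F where "F \<delta> = {\<omega> \<in> space M. err \<delta> \<omega> > 1 / sqrt 2}" for \<delta>
  define s where "s = \<sigma> 1"
  define q where "q = 1 - s\<^sup>2"
  define d where "d n = 9 / 10 * s * q ^ n / \<tau>" for n
  have s: "0 < s" and less: "\<sigma> 1 < 1"
    using sigma_pos[of 1] sigma_eq sigma_less by (simp_all add: s_def)
  have q: "0 < q" "q < 1" using contraction_factor[of 1] less by (auto simp: q_def s_def)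
  have d_pos: "0 < d n" for n using s q tau by (simp add: d_def)
  have ind: "indep_vars (\<lambda>_. borel) (\<lambda>j. Z (u j)) {1..}"
    and dist: "\<And>j. 1 \<le> j \<Longrightarrow> distributed M lborel (Z (u j)) (\<lambda>t. ennreal (std_normal_density t))"
    using Z by (auto simp: gaussian_white_noise_def)
  have [measurable]: "Z (u j) \<in> borel_measurable M" if "1 \<le> j" for j
    using distributed_measurable[OF dist[OF that]] by simp
  have y_eq: "y \<delta> \<omega> (u j) = \<sigma> j * (xdag \<bullet> v j) + \<delta> * Z (u j) \<omega>" if "1 \<le> j" for \<delta> \<omega> j
    using that by (simp add: y noisy_data_def inner_K_u)
  have [measurable]: "F \<delta> \<in> events" if "0 < \<delta>" for \<delta>
  proof -
    have "(\<lambda>\<omega>. y \<delta> \<omega> (u j)) \<in> borel_measurable M" if "1 \<le> j" for j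
      using that by (simp add: y_eq)
    then have [measurable]: "err \<delta> \<in> borel_measurable M"
      unfolding err kbar[abs_def] using that tau mbar_measurable
      by (intro borel_measurable_landweber_error) auto
    show ?thesis unfolding F_def by measurable
  qed
  have large_probability: "1 / 48 \<le> prob (F (d n))" if n: "1 \<le> n" and small: "400 * d n \<le> s" for n
  proof -
    \<comment> \<open>\<open>A\<close> and \<open>B\<close> are the events of large noise, with \<open>8/9 + 4/55 < 47/48\<close> bounding their joint
      probability; \<open>C\<close> contains the values of \<open>z\<^sub>1\<close> for which some iterate reproduces the \<open>v\<^sub>1\<close>
      component exactly\<close>
    define A where
      "A = {\<omega> \<in> space M. \<exists>i. 4 * real (Suc i) \<le> (\<Sum>j=3..3+i. (Z (u j) \<omega>)\<^sup>2)}"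
    define B where "B = {\<omega> \<in> space M. 144 \<le> (\<Sum>j\<in>{1, 2}. (Z (u j) \<omega>)\<^sup>2)}"
    define C where "C = range (\<lambda>k. (s / (1 - q ^ k) - s) / d n)"
    have A: "A \<in> events" "prob A \<le> 8 / 9"
    proof -
      show "A \<in> events" unfolding A_def by measurable
      show "prob A \<le> 8 / 9"
        unfolding A_def by (rule some_chi_square_sum_large) (auto intro!: indep_vars_subset[OF ind] dist)
    qed
    have "prob B \<le> 2 ^ card {1::nat, 2} * exp (- (3 / 8 * 144))"
      unfolding B_def by (rule chi_square_tail) (auto intro!: indep_vars_subset[OF ind] dist)
    also have "\<dots> \<le> 4 / 55"
      using exp_ge_add_one_self[of 54] by (simp add: exp_minus field_simps)
    finally have prob_B: "prob B \<le> 4 / 55" .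
    have B: "B \<in> events" unfolding B_def by measurable auto
    have "\<omega> \<in> F (d n) \<union> A \<union> B" if \<omega>: "\<omega> \<in> space M" "Z (u 1) \<omega> \<notin> C" for \<omega>
    proof (rule ccontr)
      assume not: "\<omega> \<notin> F (d n) \<union> A \<union> B"
      define \<phi> where "\<phi> = y (d n) \<omega>"
      define z where "z j = Z (u j) \<omega>" for j
      have \<phi>1: "\<phi> (u 1) = \<sigma> 1 + d n * z 1" and \<phi>2: "\<phi> (u 2) = \<sigma> 1 / sqrt 2 + d n * z 2"
        and \<phi>3: "\<And>j. 3 \<le> j \<Longrightarrow> \<phi> (u j) = d n * z j"
        using sigma_eq by (simp_all add: \<phi>_def y_eq xdag inner_simps inner_v z_def)
      have "(\<Sum>j=3..m. (z j)\<^sup>2) \<le> 4 * (real m - 2)" if "3 \<le> m" for m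
      proof -
        have "(\<Sum>j=3..3+(m-3). (z j)\<^sup>2) < 4 * real (Suc (m - 3))"
          using not \<omega>(1) unfolding A_def z_def by (auto simp: not_le)
        then show ?thesis using that by (simp add: of_nat_diff)
      qed
      moreover have "(z 1)\<^sup>2 + (z 2)\<^sup>2 \<le> 144"
        using not \<omega>(1) by (simp add: B_def z_def)
      moreover have "\<tau> * d n = 9 / 10 * \<sigma> 1 * (1 - (\<sigma> 1)\<^sup>2) ^ n"
        using tau by (simp add: d_def q_def s_def)
      ultimately have "is_dp_argmax K u \<tau> (d n) \<phi> m \<longleftrightarrow> m = 1" for m
        using discrepancy_principle_stops_earlier[OF sigma_eq less tau n _ _ _ \<phi>1 \<phi>2 \<phi>3]
          small[unfolded s_def]
        by (intro dp_argmax_unique_one[where n = n]) auto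
      then have "mbar (d n) \<omega> = 1"
        using mbar[OF d_pos \<omega>(1)] unfolding \<phi>_def by blast
      moreover have "(1 - (1 - (\<sigma> 1)\<^sup>2) ^ k) * \<phi> (u 1) \<noteq> \<sigma> 1" for k
      proof
        assume eq: "(1 - (1 - (\<sigma> 1)\<^sup>2) ^ k) * \<phi> (u 1) = \<sigma> 1"
        then have eq': "(1 - q ^ k) * (s + d n * z 1) = s"
          by (simp only: \<phi>1 q_def s_def)
        with s have "1 - q ^ k \<noteq> 0" by auto
        with eq' have "z 1 = (s / (1 - q ^ k) - s) / d n"
          using d_pos[of n] by (simp add: field_simps)
        with \<omega>(2) show False by (auto simp: C_def z_def)
      qed
      ultimately have "1 / sqrt 2 < err (d n) \<omega>"
        using landweber_error_one[of "kbar (d n) \<omega>" \<phi>] by (simp add: err \<phi>_def xdag)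
      with not \<omega>(1) show False by (simp add: F_def)
    qed
    moreover have "AE \<omega> in M. Z (u 1) \<omega> \<notin> C"
      by (rule AE_avoids_countable[OF dist]) (auto simp: C_def)
    ultimately have "AE \<omega> in M. \<omega> \<in> F (d n) \<union> A \<union> B"
      by (auto elim: AE_mp)
    then have "1 = prob (F (d n) \<union> A \<union> B)"
      using A B d_pos by (subst prob_eq_1[THEN iffD2]) auto
    also have "\<dots> \<le> prob (F (d n)) + prob A + prob B"
      using A B d_pos by (intro order_trans[OF measure_Un_le] add_right_mono measure_Un_le) auto
    finally show ?thesis using A(2) prob_B by simp
  qed
  have "d \<longlonglongrightarrow> 9 / 10 * s * 0 / \<tau>"
    unfolding d_def[abs_def] by (intro tendsto_intros LIMSEQ_power_zero) (use q tau in auto)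
  then have d_0: "d \<longlonglongrightarrow> 0" by simp
  then have d_right: "filterlim d (at_right 0) sequentially"
    using d_pos by (simp add: filterlim_at less_imp_neq[symmetric])
  have "\<forall>\<^sub>F n in sequentially. d n < s / 400"
    using d_0 by (rule order_tendstoD) (use s in simp)
  then have large: "\<forall>\<^sub>F n in sequentially. 1 / 48 \<le> prob (F (d n))"
    using eventually_ge_at_top[of 1] by eventually_elim (rule large_probability, auto)
  have not_small: False if "\<forall>\<^sub>F \<delta> in at_right 0. prob (F \<delta>) < 1 / 48"
  proof -
    have "\<forall>\<^sub>F n in sequentially. False"
      using large eventually_compose_filterlim[OF that d_right] by eventually_elim simp
    then show False by simp
  qed
  show ?thesis
  proof
    show "ereal (1 / 48) \<le> Limsup (at_right 0)
        (\<lambda>\<delta>. ereal (measure M {\<omega> \<in> space M. err \<delta> \<omega> > 1 / sqrt 2}))"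
      unfolding F_def[symmetric]
    proof (rule ccontr)
      assume "\<not> ereal (1 / 48) \<le> Limsup (at_right 0) (\<lambda>\<delta>. ereal (prob (F \<delta>)))"
      then have "\<forall>\<^sub>F \<delta> in at_right 0. ereal (prob (F \<delta>)) < ereal (1 / 48)"
        by (intro Limsup_lessD) (simp only: not_le)
      then show False by (intro not_small) (simp only: less_ereal.simps)
    qed
    show "\<not> (\<forall>\<epsilon>>0. ((\<lambda>\<delta>. measure M {\<omega> \<in> space M. err \<delta> \<omega> > \<epsilon>}) \<longlongrightarrow> 0) (at_right 0))"
    proof
      assume *: "\<forall>\<epsilon>>0. ((\<lambda>\<delta>. measure M {\<omega> \<in> space M. err \<delta> \<omega> > \<epsilon>}) \<longlongrightarrow> 0) (at_right 0)"
      have "((\<lambda>\<delta>. prob (F \<delta>)) \<longlongrightarrow> 0) (at_right 0)"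
        unfolding F_def using *[rule_format, of "1 / sqrt 2"] by simp
      then have "\<forall>\<^sub>F \<delta> in at_right 0. prob (F \<delta>) < 1 / 48"
        by (rule order_tendstoD) simp
      then show False by (rule not_small)
    qed
  qed
qed

end
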